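(* Let $T,\psi\in(0,\infty)$, $\phi,g,h_0,h_1\in C(\mathbb R,\mathbb R)$, let $V=C^{1,2}([0,T]\times\mathbb R,\mathbb R)\times C([0,T],\mathbb R)$, let $u=(u_1,u_2)=((u_1(t,x))_{(t,x)\in[0,T]\times\mathbb R},(u_2(t))_{t\in[0,T]})\in V$, let $D=\{(t,x)\in(0,T)\times(0,\infty)\colon x<u_2(t)\}$, assume for all $(t,x)\in D$ that $$\tfrac{\partial u_1}{\partial t}(t,x)=\tfrac{\partial^2u_1}{\partial x^2}(t,x),\qquad\tfrac{\partial u_1}{\partial x}(t,0)=g(t),\qquad u_1(t,u_2(t))=h_0(t),$$ $$\tfrac{\partial u_1}{\partial x}(t,u_2(t))=h_1(t),\qquad u_1(0,x)=\phi(x),\qquad\text{and}\qquad u_2(0)=\psi,$$ let $(\Omega,\mathcal F,\mathbb P)$ be a probability space, let $\mathbb T\colon\Omega\to\mathbb R$ and $\mathbb X\colon\Omega\to\mathbb R$ be random variables which satisfy for all non-empty open $U\subseteq D$ that $0<\mathbb P((\mathbb T,\mathbb X)\in U)\leq\mathbb P((\mathbb T,\mathbb X)\in D)=1$, and let $\ell\colon V\to[0,\infty]$ satisfy for all $v=(v_1,v_2)\in V$ that $$\begin{aligned}\ell(v)=\mathbb E\Bigl[&\bigl|\tfrac{\partial v_1}{\partial t}(\mathbb T,\mathbb X)-\tfrac{\partial^2v_1}{\partial x^2}(\mathbb T,\mathbb X)\bigr|^2+\bigl|\tfrac{\partial v_1}{\partial x}(\mathbb T,0)-g(\mathbb T)\bigr|^2+\bigl|v_1(\mathbb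 T,v_2(\mathbb T))-h_0(\mathbb T)\bigr|^2\\&+\bigl|\tfrac{\partial v_1}{\partial x}(\mathbb T,v_2(\mathbb T))-h_1(\mathbb T)\bigr|^2+\bigl|v_1(0,\mathbb X)-\phi(\mathbb X)\bigr|^2+\bigl|v_2(0)-\psi\bigr|^2\Bigr].\end{aligned}$$ Then (i) for all $v=(v_1,v_2)\in V$ it holds that $\ell(v)=\inf_{w\in V}\ell(w)$ if and only if it holds for all $(t,x)\in D$ that $$\tfrac{\partial v_1}{\partial t}(t,x)=\tfrac{\partial^2v_1}{\partial x^2}(t,x),\qquad\tfrac{\partial v_1}{\partial x}(t,0)=g(t),\qquad v_1(t,v_2(t))=h_0(t),$$ $$\tfrac{\partial v_1}{\partial x}(t,v_2(t))=h_1(t),\qquad v_1(0,x)=\phi(x),\qquad\text{and}\qquad v_2(0)=\psi,$$ and (ii) there exists $v\in V$ such that $\ell(v)=\inf_{w\in V}\ell(w)$.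
   Context: $C(A,B)$ denotes the set of continuous functions from $A$ to $B$. $C^{1,2}([0,T]\times\mathbb R,\mathbb R)$ is the set of continuous functions $(t,x)\mapsto v(t,x)$ which are once continuously differentiable in $t\in[0,T]$ (one-sided at the endpoints) and twice continuously differentiable in $x\in\mathbb R$, with $\frac{\partial v}{\partial t},\frac{\partial v}{\partial x},\frac{\partial^2v}{\partial x^2}$ continuous on $[0,T]\times\mathbb R$. The integrand in $\ell(v)$ is defined on the event $\{(\mathbb T,\mathbb X)\in D\}$, which has probability one, and the expectation is understood accordingly. *)

theory Defs
  imports "HOL-Probability.Probability"
begin

text \<open>
  A function on \<open>[0,T] \<times> \<real>\<close> (resp. on \<open>[0,T]\<close>) is represented by a total function
  of which only the values on \<open>{0..T} \<times> UNIV\<close> (resp. on \<open>{0..T}\<close>) matter.  The time derivative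
  is therefore taken within \<open>{0..T}\<close>: it is one-sided at the endpoints and never looks at values
  outside of the domain.
\<close>

definition dt :: "real \<Rightarrow> (real \<times> real \<Rightarrow> real) \<Rightarrow> real \<times> real \<Rightarrow> real" where
  "dt T v = (\<lambda>(t, x). vector_derivative (\<lambda>s. v (s, x)) (at t within {0..T}))"

definition dx :: "(real \<times> real \<Rightarrow> real) \<Rightarrow> real \<times> real \<Rightarrow> real" where
  "dx v = (\<lambda>(t, x). deriv (\<lambda>y. v (t, y)) x)"

definition C12 :: "real \<Rightarrow> (real \<times> real \<Rightarrow> real) set" where
  "C12 T = {v. continuous_on ({0..T} \<times> UNIV) v
    \<and> (\<forall>t\<in>{0..T}. \<forall>x. (\<lambda>s. v (s, x)) differentiable (at t within {0..T}))
    \<and> (\<forall>t\<in>{0..T}. \<forall>x. (\<lambda>y. v (t, y)) differentiable (at x))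
    \<and> (\<forall>t\<in>{0..T}. \<forall>x. (\<lambda>y. dx v (t, y)) differentiable (at x))
    \<and> continuous_on ({0..T} \<times> UNIV) (dt T v)
    \<and> continuous_on ({0..T} \<times> UNIV) (dx v)
    \<and> continuous_on ({0..T} \<times> UNIV) (dx (dx v))}"

definition V_space :: "real \<Rightarrow> ((real \<times> real \<Rightarrow> real) \<times> (real \<Rightarrow> real)) set" where
  "V_space T = C12 T \<times> {v2. continuous_on {0..T} v2}"

definition free_boundary_domain :: "real \<Rightarrow> (real \<Rightarrow> real) \<Rightarrow> (real \<times> real) set" where
  "free_boundary_domain T u2 = {(t, x). 0 < t \<and> t < T \<and> 0 < x \<and> x < u2 t}"

text \<open>
  The set \<open>D\<close> is a separate parameter, since the candidate \<open>(v1, v2)\<close> is tested on the domain below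
  the given free boundary \<open>u2\<close> and not on the one below its own second component \<open>v2\<close>.
\<close>

definition solves_free_boundary_problem ::
  "real \<Rightarrow> real \<Rightarrow> (real \<Rightarrow> real) \<Rightarrow> (real \<Rightarrow> real) \<Rightarrow> (real \<Rightarrow> real) \<Rightarrow> (real \<Rightarrow> real)
    \<Rightarrow> (real \<times> real) set \<Rightarrow> (real \<times> real \<Rightarrow> real) \<Rightarrow> (real \<Rightarrow> real) \<Rightarrow> bool" where
  "solves_free_boundary_problem T \<psi> \<phi> g h0 h1 D v1 v2 \<longleftrightarrow> (\<forall>(t, x)\<in>D.
      dt T v1 (t, x) = dx (dx v1) (t, x)
    \<and> dx v1 (t, 0) = g t
    \<and> v1 (t, v2 t) = h0 t
    \<and> dx v1 (t, v2 t) = h1 t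
    \<and> v1 (0, x) = \<phi> x
    \<and> v2 0 = \<psi>)"

definition squared_residual ::
  "real \<Rightarrow> real \<Rightarrow> (real \<Rightarrow> real) \<Rightarrow> (real \<Rightarrow> real) \<Rightarrow> (real \<Rightarrow> real) \<Rightarrow> (real \<Rightarrow> real)
    \<Rightarrow> (real \<times> real \<Rightarrow> real) \<Rightarrow> (real \<Rightarrow> real) \<Rightarrow> real \<Rightarrow> real \<Rightarrow> real" where
  "squared_residual T \<psi> \<phi> g h0 h1 v1 v2 t x =
      \<bar>dt T v1 (t, x) - dx (dx v1) (t, x)\<bar>\<^sup>2 + \<bar>dx v1 (t, 0) - g t\<bar>\<^sup>2
    + \<bar>v1 (t, v2 t) - h0 t\<bar>\<^sup>2 + \<bar>dx v1 (t, v2 t) - h1 t\<bar>\<^sup>2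
    + \<bar>v1 (0, x) - \<phi> x\<bar>\<^sup>2 + \<bar>v2 0 - \<psi>\<bar>\<^sup>2"

end

theory Submission
  imports Defs
begin

text \<open>
  The loss is the expectation over \<open>D\<close> of a continuous nonnegative function of
  \<open>(TT, XX)\<close>, and it vanishes at the given solution; hence its infimum is 0 and the
  minimizers are the zeros of the loss.  If the residual were positive at a point of \<open>D\<close>, it would
  be bounded below by a positive constant on an open subset of \<open>D\<close>, which has positive probability,
  so the loss would be positive.
\<close>

text \<open>The strict inequalities exhibit the domain as a preimage of \<open>{0<..}\<close> under
  a map continuous on an open set. Openness makes relatively open subsets of \<open>D\<close> open
  in the plane, so that \<open>supp\<close> applies to them.\<close>

lemma open_free_boundary_domain:
  assumes "continuous_on {0..T} u"
  shows "open (free_boundary_domain T u)"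
proof -
  have cont: "continuous_on ({0<..<T} \<times> {0<..}) (\<lambda>z. u (fst z) - snd z)"
    by (intro continuous_intros continuous_on_compose2[OF assms]) auto
  have "free_boundary_domain T u
      = (\<lambda>z. u (fst z) - snd z) -` {0<..} \<inter> ({0<..<T} \<times> {0<..})"
    by (auto simp: free_boundary_domain_def)
  then show ?thesis
    using continuous_open_preimage[OF cont, of "{0<..}"] by (simp add: open_Times Int_commute)
qed

text \<open>A Markov-type bound: the integral dominates \<open>c\<close> times the mass of a
  superlevel set of \<open>f\<close>. The conclusion is only \<open>f z \<le> 0\<close> because
  \<open>ennreal\<close> sends negative values to 0, so the integral sees just the positive part of
  \<open>f\<close>.\<close>

lemma set_nn_integral_eq_0_imp_nonpos:
  fixes Z :: "'w \<Rightarrow> 'a::topological_space" and f :: "'a \<Rightarrow> real"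
  assumes Z: "Z \<in> borel_measurable M" and D: "open D" and f: "continuous_on D f"
    and pos: "\<And>U. open U \<Longrightarrow> U \<noteq> {} \<Longrightarrow> U \<subseteq> D \<Longrightarrow> 0 < emeasure M (Z -` U \<inter> space M)"
    and zero: "(\<integral>\<^sup>+\<omega>\<in>{\<omega> \<in> space M. Z \<omega> \<in> D}. ennreal (f (Z \<omega>)) \<partial>M) = 0"
    and z: "z \<in> D"
  shows "f z \<le> 0"
proof (rule ccontr)
  assume "\<not> f z \<le> 0"
  \<comment> \<open>Any level strictly between 0 and \<open>f z\<close> would do:
    \<open>c < f z\<close> puts \<open>z\<close> into \<open>U\<close>, and \<open>0 < c\<close>
    makes the lower bound for the integral positive.\<close>
  define c where "c = f z / 2"
  define U where "U = D \<inter> f -` {c<..}"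
  have c: "0 < c" "c < f z"
    using \<open>\<not> f z \<le> 0\<close> by (auto simp: c_def)
  have U: "open U"
    unfolding U_def by (rule continuous_open_preimage[OF f D]) simp
  have "z \<in> U"
    using z c by (simp add: U_def)
  then have "0 < emeasure M (Z -` U \<inter> space M)"
    using U by (intro pos) (auto simp: U_def)
  then have "0 < ennreal c * emeasure M (Z -` U \<inter> space M)"
    using c by (simp add: ennreal_zero_less_mult_iff)
  also have "\<dots> = (\<integral>\<^sup>+\<omega>. ennreal c * indicator (Z -` U \<inter> space M) \<omega> \<partial>M)"
    using measurable_sets[OF Z, of U] U by (simp add: nn_integral_cmult_indicator)
  also have "\<dots> \<le> (\<integral>\<^sup>+\<omega>\<in>{\<omega> \<in> space M. Z \<omega> \<in> D}. ennreal (f (Z \<omega>)) \<partial>M)"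
    by (intro nn_integral_mono) (auto simp: U_def indicator_def intro!: ennreal_leI)
  finally show False
    using zero by simp
qed

text \<open>Each term composes a continuous function with a continuous choice of evaluation point.
  The full strip is the right setting, since the points \<open>(t, 0)\<close>,
  \<open>(t, v2 t)\<close> and \<open>(0, x)\<close> may lie outside the free boundary
  domain.\<close>

lemma continuous_on_squared_residual:
  assumes v: "(v1, v2) \<in> V_space T"
    and "continuous_on UNIV \<phi>" "continuous_on UNIV g"
    and "continuous_on UNIV h0" "continuous_on UNIV h1"
  shows "continuous_on ({0..T} \<times> UNIV)
    (\<lambda>z. squared_residual T \<psi> \<phi> g h0 h1 v1 v2 (fst z) (snd z))"
proof -
  let ?S = "{0..T} \<times> (UNIV :: real set)"
  have v1: "continuous_on ?S v1" "continuous_on ?S (dt T v1)"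
      "continuous_on ?S (dx v1)" "continuous_on ?S (dx (dx v1))"
    and v2: "continuous_on {0..T} v2"
    using v by (auto simp: V_space_def C12_def)
  have v2': "continuous_on ?S (\<lambda>z. v2 (fst z))"
    by (rule continuous_on_compose2[OF v2 continuous_on_fst[OF continuous_on_id]]) auto
  have along: "continuous_on ?S (\<lambda>z. w (a z, b z))"
    if "continuous_on ?S w" "continuous_on ?S a" "continuous_on ?S b" "\<And>z. z \<in> ?S \<Longrightarrow> a z \<in> {0..T}"
    for w :: "real \<times> real \<Rightarrow> real" and a b :: "real \<times> real \<Rightarrow> real"
    by (rule continuous_on_compose2[OF that(1) continuous_on_Pair[OF that(2,3)]])
      (use that(4) in blast)
  have "continuous_on ?S (\<lambda>z. h (a z))"
    if "continuous_on UNIV h" "continuous_on ?S a" for h :: "real \<Rightarrow> real" and a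
    by (rule continuous_on_compose2[OF that]) simp
  note outer = this[OF assms(2) continuous_on_snd[OF continuous_on_id]]
    this[OF assms(3) continuous_on_fst[OF continuous_on_id]]
    this[OF assms(4) continuous_on_fst[OF continuous_on_id]]
    this[OF assms(5) continuous_on_fst[OF continuous_on_id]]
  \<comment> \<open>Evaluating \<open>v1\<close> at time 0 requires 0 to lie in
    \<open>{0..T}\<close>, hence the condition \<open>0 \<le> T\<close>. For negative
    \<open>T\<close> the strip is empty and the claim is trivial.\<close>
  have "continuous_on ?S (\<lambda>z. dt T v1 (fst z, snd z))"
    "continuous_on ?S (\<lambda>z. dx (dx v1) (fst z, snd z))"
    "continuous_on ?S (\<lambda>z. dx v1 (fst z, 0))"
    "continuous_on ?S (\<lambda>z. v1 (fst z, v2 (fst z)))"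
    "continuous_on ?S (\<lambda>z. dx v1 (fst z, v2 (fst z)))"
    "continuous_on ?S (\<lambda>z. v1 (0, snd z))"
    if "0 \<le> T"
    by (rule along; use v1 v2' that in \<open>auto intro!: continuous_on_fst continuous_on_snd continuous_on_id continuous_on_const\<close>)+
  then show ?thesis
    unfolding squared_residual_def
    by (cases "0 \<le> T") (auto intro!: continuous_on_add continuous_on_power continuous_on_rabs
        continuous_on_diff continuous_on_const outer)
qed

lemma squared_residual_nonneg: "0 \<le> squared_residual T \<psi> \<phi> g h0 h1 v1 v2 t x"
  by (simp add: squared_residual_def)

text \<open>A sum of squares vanishes exactly when every summand does.\<close>

lemma solves_free_boundary_problem_iff_squared_residual:
  "solves_free_boundary_problem T \<psi> \<phi> g h0 h1 D v1 v2 \<longleftrightarrow>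
    (\<forall>(t, x)\<in>D. squared_residual T \<psi> \<phi> g h0 h1 v1 v2 t x = 0)"
  by (simp add: solves_free_boundary_problem_def squared_residual_def add_nonneg_eq_0_iff)

theorem theorem2p13:
  fixes T \<psi> :: real
    and \<phi> g h0 h1 :: "real \<Rightarrow> real"
    and u1 :: "real \<times> real \<Rightarrow> real" and u2 :: "real \<Rightarrow> real"
    and V :: "((real \<times> real \<Rightarrow> real) \<times> (real \<Rightarrow> real)) set"
    and D :: "(real \<times> real) set"
    and M :: "'w measure"
    and TT XX :: "'w \<Rightarrow> real"
    and ell :: "(real \<times> real \<Rightarrow> real) \<times> (real \<Rightarrow> real) \<Rightarrow> ennreal"
  assumes "0 < T" and "0 < \<psi>"
    and "continuous_on UNIV \<phi>" and "continuous_on UNIV g"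
    and "continuous_on UNIV h0" and "continuous_on UNIV h1"
    and V: "V = V_space T"
    and u: "(u1, u2) \<in> V"
    and D: "D = free_boundary_domain T u2"
    and sol: "solves_free_boundary_problem T \<psi> \<phi> g h0 h1 D u1 u2"
    and "prob_space M"
    and "TT \<in> borel_measurable M" and "XX \<in> borel_measurable M"
    and supp: "\<forall>U. open U \<and> U \<noteq> {} \<and> U \<subseteq> D \<longrightarrow>
        0 < \<P>(\<omega> in M. (TT \<omega>, XX \<omega>) \<in> U)
      \<and> \<P>(\<omega> in M. (TT \<omega>, XX \<omega>) \<in> U) \<le> \<P>(\<omega> in M. (TT \<omega>, XX \<omega>) \<in> D)
      \<and> \<P>(\<omega> in M. (TT \<omega>, XX \<omega>) \<in> D) = 1"
    and ell: "\<forall>(v1, v2)\<in>V. ell (v1, v2) =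
        (\<integral>\<^sup>+\<omega>\<in>{\<omega> \<in> space M. (TT \<omega>, XX \<omega>) \<in> D}.
          ennreal (squared_residual T \<psi> \<phi> g h0 h1 v1 v2 (TT \<omega>) (XX \<omega>)) \<partial>M)"
  shows "(\<forall>(v1, v2)\<in>V. ell (v1, v2) = (INF w\<in>V. ell w)
            \<longleftrightarrow> solves_free_boundary_problem T \<psi> \<phi> g h0 h1 D v1 v2)
       \<and> (\<exists>v\<in>V. ell v = (INF w\<in>V. ell w))"
proof -
  interpret prob_space M by fact
  note [measurable] = \<open>TT \<in> borel_measurable M\<close> \<open>XX \<in> borel_measurable M\<close>
  have "open D"
    using u unfolding V D by (auto simp: V_space_def intro: open_free_boundary_domain)
  have DT: "D \<subseteq> {0..T} \<times> UNIV"
    by (auto simp: D free_boundary_domain_def)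
  have zero_iff: "ell (v1, v2) = 0 \<longleftrightarrow> solves_free_boundary_problem T \<psi> \<phi> g h0 h1 D v1 v2"
    if v: "(v1, v2) \<in> V" for v1 v2
  proof
    let ?r = "squared_residual T \<psi> \<phi> g h0 h1 v1 v2"
    have ell_v: "ell (v1, v2) =
        (\<integral>\<^sup>+\<omega>\<in>{\<omega> \<in> space M. (TT \<omega>, XX \<omega>) \<in> D}. ennreal (?r (TT \<omega>) (XX \<omega>)) \<partial>M)"
      using ell v by blast
    show "ell (v1, v2) = 0" if "solves_free_boundary_problem T \<psi> \<phi> g h0 h1 D v1 v2"
    proof -
      \<comment> \<open>The integrands agree at every point of \<open>M\<close>: the residual
        vanishes when the sample lies in \<open>D\<close>, and the indicator vanishes
        otherwise.\<close>
      have "ell (v1, v2) = (\<integral>\<^sup>+\<omega>. 0 \<partial>M)"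
        unfolding ell_v using that
        by (intro nn_integral_cong)
          (auto simp: solves_free_boundary_problem_iff_squared_residual indicator_def)
      then show ?thesis by simp
    qed
    assume "ell (v1, v2) = 0"
    \<comment> \<open>Together with \<open>squared_residual_nonneg\<close> this bound forces the
      residual to be 0 on all of \<open>D\<close>, not merely almost everywhere.\<close>
    have "?r (fst z) (snd z) \<le> 0" if "z \<in> D" for z
    proof (rule set_nn_integral_eq_0_imp_nonpos[where Z = "\<lambda>\<omega>. (TT \<omega>, XX \<omega>)" and M = M])
      show "continuous_on D (\<lambda>z. ?r (fst z) (snd z))"
        using continuous_on_subset[OF continuous_on_squared_residual[OF v[unfolded V] assms(3-6)] DT] .
      show "0 < emeasure M ((\<lambda>\<omega>. (TT \<omega>, XX \<omega>)) -` U \<inter> space M)"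
        if "open U" "U \<noteq> {}" "U \<subseteq> D" for U
      proof -
        have "(\<lambda>\<omega>. (TT \<omega>, XX \<omega>)) -` U \<inter> space M = {\<omega> \<in> space M. (TT \<omega>, XX \<omega>) \<in> U}"
          by blast
        moreover have "0 < \<P>(\<omega> in M. (TT \<omega>, XX \<omega>) \<in> U)"
          using supp that by blast
        ultimately show ?thesis
          by (simp add: emeasure_eq_measure)
      qed
      show "(\<lambda>\<omega>. (TT \<omega>, XX \<omega>)) \<in> borel_measurable M"
        by measurable
      show "(\<integral>\<^sup>+\<omega>\<in>{\<omega> \<in> space M. (TT \<omega>, XX \<omega>) \<in> D}.
          ennreal (?r (fst (TT \<omega>, XX \<omega>)) (snd (TT \<omega>, XX \<omega>))) \<partial>M) = 0"
        using \<open>ell (v1, v2) = 0\<close> unfolding ell_v fst_conv snd_conv .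
    qed fact+
    then show "solves_free_boundary_problem T \<psi> \<phi> g h0 h1 D v1 v2"
      unfolding solves_free_boundary_problem_iff_squared_residual
      by (auto intro: antisym squared_residual_nonneg)
  qed
  have ell_u: "ell (u1, u2) = 0"
    using zero_iff[OF u] sol by simp
  \<comment> \<open>0 is the least element of \<open>ennreal\<close>, and it is attained at
    \<open>(u1, u2)\<close>, which is also the witness for the existence of a minimizer.\<close>
  then have "(INF w\<in>V. ell w) = 0"
    using INF_lower[OF u, of ell] by simp
  then show ?thesis
    using ell_u u by (auto simp only: zero_iff intro!: bexI[of _ "(u1, u2)"])
qed

end
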